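(* For every integer $k \geq 2$, \[ \big\lfloor \log_2 \pi(\eta_k) \big\rfloor \leq \mathrm{VCdim}(\mathcal{H}'_k) \leq \mathrm{VCdim}(\mathcal{H}_k) \leq \lceil \log_2(k-1) \rceil + 1, \] where $\eta_k := \lfloor (\log_2 k)/2 \rfloor$.
   Context: Let $\mathcal{X} = \{n \in \mathbb{N} : n \geq 2\}$, where $\mathbb{N}$ is the set of positive integers. For $d, k \in \mathcal{X}$ define $h_{d,k} : \mathcal{X} \to \{0,1\}$ by $h_{d,k}(x) = 0$ if and only if $x \in \{2d, 3d, \dots, kd\}$. Let $\mathcal{H}_k = \{h_{d,k} : d \in \mathcal{X}\}$ and $\mathcal{H}'_k = \{h_{d,k} : d \in \mathcal{X},\ d \text{ prime}\}$. $\pi(x)$ denotes the number of primes less than or equal to $x$; when $\pi(\eta_k) = 0$ the leftmost quantity is read as $-\infty$, i.e. the lower bound is vacuous. A class $\mathcal{G}$ of functions $g : \mathcal{X} \to \{0,1\}$ shatters a set $C = \{c_1, \dots, c_\ell\} \subset \mathcal{X}$ of $\ell$ distinct elements if $\big|\{(g(c_1), \dots, g(c_\ell)) : g \in \mathcal{G}\}\big| = 2^\ell$. The VC-dimension $\mathrm{VCdim}(\mathcal{G})$ is the size of the largest set that $\mathcal{G}$ shatters. *)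

theory Defs
  imports
    Complex_Main
    "HOL-Library.FuncSet"
    "HOL-Library.Z2"
    "HOL-Library.Extended_Real"
    "HOL-Computational_Algebra.Primes"
begin

definition dom_X :: "nat set" where
  "dom_X = {n. n \<ge> 2}"

text \<open>
  Functions from \<open>dom_X\<close> to \<open>{0,1}\<close> are rendered as functions \<open>nat \<Rightarrow> bit\<close>. Their values
  outside \<open>dom_X\<close> are irrelevant, since only subsets of \<open>dom_X\<close> can be shattered.
\<close>

definition h :: "nat \<Rightarrow> nat \<Rightarrow> nat \<Rightarrow> bit" where
  "h d k x = (if x \<in> {j * d | j. 2 \<le> j \<and> j \<le> k} then 0 else 1)"

definition H :: "nat \<Rightarrow> (nat \<Rightarrow> bit) set" where
  "H k = {h d k | d. d \<in> dom_X}"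

definition H' :: "nat \<Rightarrow> (nat \<Rightarrow> bit) set" where
  "H' k = {h d k | d. d \<in> dom_X \<and> prime d}"

text \<open>
  The value tuple of \<open>g\<close> on the elements of \<open>C\<close> is the family \<open>restrict g C\<close> indexed by \<open>C\<close>.
\<close>

definition shatters :: "(nat \<Rightarrow> bit) set \<Rightarrow> nat set \<Rightarrow> bool" where
  "shatters G C \<longleftrightarrow>
     C \<subseteq> dom_X \<and> finite C \<and> card {restrict g C | g. g \<in> G} = 2 ^ card C"

text \<open>
  The supremum in \<open>enat\<close> is the maximum if the sizes of shattered sets are bounded, and
  \<open>\<infinity>\<close> otherwise.
\<close>

definition VCdim :: "(nat \<Rightarrow> bit) set \<Rightarrow> enat" where
  "VCdim G = Sup {enat (card C) | C. shatters G C}"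

definition prime_count :: "real \<Rightarrow> nat" where
  "prime_count x = card {p :: nat. prime p \<and> real p \<le> x}"

definition eta :: "nat \<Rightarrow> int" where
  "eta k = \<lfloor>log 2 (real k) / 2\<rfloor>"

text \<open>
  The quantity \<open>\<lfloor>log 2 n\<rfloor>\<close> with the convention that it is \<open>-\<infinity>\<close> for \<open>n = 0\<close>
  (the library's \<open>log 2 0\<close> is \<open>0\<close>).
\<close>

definition floor_log2 :: "nat \<Rightarrow> ereal" where
  "floor_log2 n = (if n = 0 then - \<infinity> else ereal (real_of_int \<lfloor>log 2 (real n)\<rfloor>))"

end

theory Submission
  imports Defs
begin

text \<open>
  A class shatters \<open>C\<close> iff every subset of \<open>C\<close> is the zero set, within \<open>C\<close>, of one of its
  members (\<open>shatters_iff\<close>). Monotonicity of the VC-dimension, and with it the middle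
  inequality, follows at once.

  For the upper bound, fix a point \<open>x\<close> of a shattered set with \<open>l\<close> elements. The \<open>2 ^ (l - 1)\<close>
  subsets through \<open>x\<close> are cut out by parameters \<open>d\<close> for which \<open>x\<close> is one of
  \<open>2 d, \<dots>, k d\<close>, and there are at most \<open>k - 1\<close> of these (\<open>shatters_H_card\<close>).

  For the lower bound, let \<open>2 ^ m\<close> be at most the number of primes up to \<open>n = \<eta>\<^sub>k\<close>, and let
  \<open>A\<close> have \<open>m\<close> elements. Label the subsets of \<open>A\<close> by distinct primes \<open>f S \<le> n\<close>, and put
  \<open>c i = 2 * (\<Prod>T | T \<subseteq> A \<and> i \<in> T. f T)\<close>. Divisibility by \<open>f S\<close> then tells whether
  \<open>i \<in> S\<close>, so the zero sets of the \<open>h (f S) k\<close> realise all subsets of the set of the \<open>c i\<close>,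
  provided that each quotient \<open>c i div f S\<close> with \<open>i \<in> S\<close> lies between \<open>2\<close> and \<open>k\<close>.
  The factor \<open>2\<close> in \<open>c i\<close> keeps the quotient at least \<open>2\<close>; it disturbs no divisibility because
  the prime \<open>2\<close> is used as the label of \<open>A\<close> itself, and \<open>f A\<close> divides every \<open>c i\<close> anyway.
  As \<open>2 \<le> f S\<close>, the quotient is at most the product of all primes up to \<open>n\<close>, which is at most
  \<open>4 ^ n\<close> by Erdos's argument with binomial coefficients (\<open>primorial_le\<close>); and
  \<open>4 ^ n \<le> k\<close> is exactly what the choice of \<open>\<eta>\<^sub>k\<close> guarantees.
\<close>

section \<open>The product of the primes up to a bound\<close>

lemma prod_primes_dvd:
  fixes N :: nat
  assumes "finite A" "\<And>p. p \<in> A \<Longrightarrow> prime p" "\<And>p. p \<in> A \<Longrightarrow> p dvd N"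
  shows "\<Prod>A dvd N"
  using assms
proof (induction A rule: finite_induct)
  case (insert p A)
  have "coprime p (\<Prod>A)"
    using insert by (intro prod_coprime_right) (auto intro!: primes_coprime)
  then show ?case
    using insert by (auto intro!: divides_mult)
qed simp

text \<open>
  By symmetry the first half of an odd row of Pascal's triangle sums to half of \<open>2 ^ (2 * m + 1)\<close>,
  and the binomial coefficient in question is the last summand of that half.
\<close>

lemma central_binomial_odd_le: "(2 * m + 1) choose m \<le> (4 :: nat) ^ m"
proof -
  have "(2 * m + 1) choose m \<le> (\<Sum>i\<le>m. (2 * m + 1) choose i)"
    by (rule member_le_sum) auto
  then show ?thesis
    by (simp only: binomial_r_part_sum power_mult) simp
qed

text \<open>
  Such a prime occurs in the numerator of \<open>(2 * m + 1)! / (m! * (m + 1)!)\<close> and is too large to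
  occur in the denominator.
\<close>

lemma prime_dvd_central_binomial:
  assumes "prime p" "m + 1 < p" "p \<le> 2 * m + 1"
  shows "p dvd (2 * m + 1) choose m"
proof -
  have "p dvd fact (2 * m + 1)"
    using assms by (simp add: prime_dvd_fact_iff del: fact_Suc)
  also have "fact (2 * m + 1) = fact m * fact (m + 1) * ((2 * m + 1) choose m)"
    using binomial_fact_lemma[of m "2 * m + 1"] by simp
  finally have "p dvd fact m \<or> p dvd fact (m + 1) \<or> p dvd (2 * m + 1) choose m"
    using assms(1) by (metis prime_dvd_mult_iff)
  then show ?thesis
    using assms by (simp add: prime_dvd_fact_iff del: fact_Suc)
qed

text \<open>
  For odd \<open>n = 2 * m + 1\<close> the primes above \<open>m + 1\<close> all divide \<open>n choose m \<le> 4 ^ m\<close>, and induction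
  handles the primes up to \<open>m + 1\<close>. An even \<open>n > 2\<close> is composite and contributes nothing new.
\<close>

lemma primorial_le: "\<Prod>{p :: nat. prime p \<and> p \<le> n} \<le> 4 ^ n"
proof (induction n rule: less_induct)
  case (less n)
  let ?P = "\<lambda>n. {p :: nat. prime p \<and> p \<le> n}"
  consider "n \<le> 1" | "n = 2" | "n > 2" "even n" | m where "n = 2 * m + 1" "m > 0"
  proof (cases "odd n \<and> n > 1")
    case True
    then obtain m where "n = 2 * m + 1" by (auto elim: oddE)
    then show ?thesis using True that(4) by simp
  next
    case False
    then show ?thesis using that(1-3) by linarith
  qed
  then show ?case
  proof cases
    case 1
    then have "?P n = {}" by (auto dest: prime_ge_2_nat)
    then show ?thesis by (simp only: prod.empty) simp
  next
    case 2
    have "?P n = {2}" using 2 by (auto dest: prime_ge_2_nat)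
    then show ?thesis using 2 by simp
  next
    case 3
    then have "\<not> prime n" using primes_dvd_imp_eq two_is_prime_nat by blast
    then have "?P n = ?P (n - 1)" by (auto simp: le_less)
    moreover have "\<Prod>(?P (n - 1)) \<le> 4 ^ (n - 1)" using 3 by (intro less.IH) auto
    moreover have "4 ^ (n - 1) \<le> (4 :: nat) ^ n" by (rule power_increasing) auto
    ultimately show ?thesis by (simp only:)
  next
    case 4
    let ?Q = "{p. prime p \<and> m + 1 < p \<and> p \<le> 2 * m + 1}"
    have "\<Prod>?Q dvd (2 * m + 1) choose m"
    proof (rule prod_primes_dvd)
      show "p dvd (2 * m + 1) choose m" if "p \<in> ?Q" for p
        using that prime_dvd_central_binomial[of p m] by blast
    qed auto
    then have "\<Prod>?Q \<le> (2 * m + 1) choose m"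
      by (rule dvd_imp_le) simp
    also have "\<dots> \<le> 4 ^ m" by (rule central_binomial_odd_le)
    finally have Q: "\<Prod>?Q \<le> 4 ^ m" .
    have "?P n = ?P (m + 1) \<union> ?Q" using 4 by auto
    then have "\<Prod>(?P n) = \<Prod>(?P (m + 1)) * \<Prod>?Q"
      by (simp only:) (rule prod.union_disjoint, auto)
    also have "\<dots> \<le> 4 ^ (m + 1) * 4 ^ m"
      using 4 by (intro mult_mono Q less.IH) auto
    also have "\<dots> = 4 ^ n" using 4 by (simp flip: power_add mult_2)
    finally show ?thesis .
  qed
qed

section \<open>Shattering in terms of zero sets\<close>

lemma inj_on_zero_set: "inj_on (\<lambda>r. {x \<in> C. r x = (0 :: bit)}) (C \<rightarrow>\<^sub>E UNIV)"
proof (rule inj_onI)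
  fix r s :: "'a \<Rightarrow> bit"
  assume r: "r \<in> C \<rightarrow>\<^sub>E UNIV" and s: "s \<in> C \<rightarrow>\<^sub>E UNIV"
    and eq: "{x \<in> C. r x = 0} = {x \<in> C. s x = 0}"
  show "r = s"
  proof (rule PiE_ext[OF r s])
    fix x assume "x \<in> C"
    then have "r x = 0 \<longleftrightarrow> s x = 0" using eq by blast
    then show "r x = s x" by (cases "r x"; cases "s x") simp_all
  qed
qed

text \<open>
  A two-valued function on \<open>C\<close> is determined by its zero set, so the number of restrictions of
  members of \<open>G\<close> is the number of their zero sets in \<open>C\<close>. That number is \<open>2 ^ card C\<close> only if no
  subset of \<open>C\<close> is missed.
\<close>

lemma shatters_iff:
  "shatters G C \<longleftrightarrow>
     C \<subseteq> dom_X \<and> finite C \<and> (\<forall>S\<subseteq>C. \<exists>g\<in>G. {x \<in> C. g x = 0} = S)"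
proof (cases "finite C")
  case True
  define Z :: "(nat \<Rightarrow> bit) \<Rightarrow> nat set" where "Z g = {x \<in> C. g x = 0}" for g
  let ?R = "{restrict g C | g. g \<in> G}"
  have "?R \<subseteq> C \<rightarrow>\<^sub>E UNIV" by auto
  then have "inj_on Z ?R"
    unfolding Z_def by (rule inj_on_subset[OF inj_on_zero_set])
  then have "card ?R = card (Z ` ?R)" by (simp only: card_image)
  also have "Z ` ?R = (\<lambda>g. Z (restrict g C)) ` G" by blast
  also have "\<dots> = Z ` G"
    by (intro image_cong refl) (auto simp: Z_def)
  finally have card_R: "card ?R = card (Z ` G)" .
  have sub: "Z ` G \<subseteq> Pow C" by (auto simp: Z_def)
  have "card ?R = 2 ^ card C \<longleftrightarrow> card (Z ` G) = card (Pow C)"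
    using True by (simp only: card_R card_Pow)
  also have "\<dots> \<longleftrightarrow> Z ` G = Pow C"
    using True sub card_subset_eq[of "Pow C" "Z ` G"] by auto
  also have "\<dots> \<longleftrightarrow> Pow C \<subseteq> Z ` G"
    using sub by (simp add: set_eq_subset)
  also have "\<dots> \<longleftrightarrow> (\<forall>S\<subseteq>C. \<exists>g\<in>G. Z g = S)"
    by (simp add: subset_iff[of "Pow C"] image_iff eq_commute)
  finally show ?thesis using True unfolding shatters_def Z_def by blast
qed (simp add: shatters_def)

lemma VCdim_ge: "shatters G C \<Longrightarrow> enat (card C) \<le> VCdim G"
  unfolding VCdim_def by (rule Sup_upper) auto

lemma VCdim_mono:
  assumes "G \<subseteq> G'"
  shows "VCdim G \<le> VCdim G'"
proof -
  have "shatters G C \<Longrightarrow> shatters G' C" for C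
    using assms unfolding shatters_iff by blast
  then show ?thesis
    unfolding VCdim_def by (intro Sup_subset_mono) auto
qed

section \<open>The upper bound\<close>

text \<open>
  If \<open>h d k x = 0\<close>, then \<open>x = j * d\<close> with \<open>2 \<le> j \<le> k\<close>, so \<open>d\<close> is one of the \<open>k - 1\<close> values
  \<open>x div j\<close>. These few parameters have to produce all subsets of \<open>C\<close> that contain \<open>x\<close>.
\<close>

lemma shatters_H_card:
  assumes "shatters (H k) C" "x \<in> C"
  shows "2 ^ (card C - 1) \<le> k - 1"
proof -
  let ?D = "(\<lambda>j. x div j) ` {2..k}"
  let ?z = "\<lambda>d. {y \<in> C. h d k y = 0}"
  have fin: "finite C"
    and sh: "\<forall>S\<subseteq>C. \<exists>g\<in>H k. {y \<in> C. g y = 0} = S"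
    using assms(1) unfolding shatters_iff by blast+
  have x: "x > 0"
    using assms unfolding shatters_iff dom_X_def by fastforce
  have "insert x ` Pow (C - {x}) \<subseteq> ?z ` ?D"
  proof
    fix S assume "S \<in> insert x ` Pow (C - {x})"
    then have S: "S \<subseteq> C" "x \<in> S" using assms(2) by auto
    obtain g where g: "g \<in> H k" "{y \<in> C. g y = 0} = S"
      using sh S(1) by blast
    then obtain d where d: "?z d = S"
      unfolding H_def by blast
    then have "h d k x = 0" using S by auto
    then obtain j where j: "x = j * d" "2 \<le> j" "j \<le> k"
      by (auto simp: h_def split: if_splits)
    then have "d = x div j" using x by simp
    then have "d \<in> ?D" using j by (intro image_eqI[of d _ j]) auto
    then show "S \<in> ?z ` ?D" using d by blast
  qed
  then have "card (insert x ` Pow (C - {x})) \<le> card (?z ` ?D)"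
    by (intro card_mono) auto
  also have "\<dots> \<le> card {2..k}"
    by (meson card_image_le finite_atLeastAtMost finite_imageI order_trans)
  also have "card (insert x ` Pow (C - {x})) = 2 ^ (card C - 1)"
  proof -
    have "inj_on (insert x) (Pow (C - {x}))" by (rule inj_onI) blast
    then show ?thesis
      using fin assms(2) by (simp add: card_image card_Pow)
  qed
  finally show ?thesis by simp
qed

lemma VCdim_H_le:
  assumes "k \<ge> 2"
  shows "ereal_of_enat (VCdim (H k)) \<le> ereal (real_of_int (\<lceil>log 2 (real k - 1)\<rceil> + 1))"
proof -
  let ?b = "\<lceil>log 2 (real k - 1)\<rceil>"
  \<comment> \<open>This covers the empty \<open>C\<close> and lets the bound pass through the naturals unchanged.\<close>
  have b: "?b \<ge> 0"
  proof -
    have "0 \<le> log 2 (real k - 1)" using assms by (subst zero_le_log_cancel_iff) auto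
    then show ?thesis by linarith
  qed
  have "card C \<le> nat (?b + 1)" if C: "shatters (H k) C" for C
  proof (cases "C = {}")
    case False
    then obtain x where "x \<in> C" by blast
    from shatters_H_card[OF C this] have "real (2 ^ (card C - 1)) \<le> real (k - 1)"
      by (simp only: of_nat_le_iff)
    then have "2 ^ (card C - 1) \<le> real k - 1"
      using assms by simp
    then have "real (card C - 1) \<le> log 2 (real k - 1)"
      by (rule le_log_of_power) simp
    then have "int (card C - 1) \<le> ?b" by linarith
    then show ?thesis by linarith
  qed simp
  then have "VCdim (H k) \<le> enat (nat (?b + 1))"
    unfolding VCdim_def by (intro Sup_least) auto
  then have "ereal_of_enat (VCdim (H k)) \<le> ereal_of_enat (enat (nat (?b + 1)))"
    by (simp only: ereal_of_enat_le_iff)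
  then show ?thesis using b by simp
qed

section \<open>The lower bound\<close>

text \<open>
  The primes \<open>f S\<close> play the role of the functions to be chosen and each point \<open>c i\<close> encodes, through
  its prime factors, the family of all \<open>S\<close> that contain \<open>i\<close>.
\<close>

lemma shatters_H'_exists:
  assumes "prime_count (real n) \<ge> 2 ^ m" "4 ^ n \<le> k"
  shows "\<exists>C. shatters (H' k) C \<and> card C = m"
proof -
  let ?P = "{p :: nat. prime p \<and> p \<le> n}"
  define A where "A = {..<m}"
  have A: "finite A" "card A = m" by (simp_all add: A_def)
  have P: "2 ^ m \<le> card ?P" using assms(1) by (simp add: prime_count_def)
  have "card ?P > 0" using P by (rule less_le_trans[rotated]) simp
  then obtain p where "prime p" "p \<le> n" unfolding card_gt_0_iff by blast
  then have two: "2 \<in> ?P" using prime_ge_2_nat[of p] by simp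
  \<comment> \<open>The prime \<open>2\<close> is reserved as the label of \<open>A\<close>; only the other subsets are labelled freely.\<close>
  have "card (Pow A - {A}) \<le> card (?P - {2})"
    using diff_le_mono[OF P, of 1] two A by (simp add: card_Pow card_Diff_singleton)
  then obtain f0 where f0: "f0 ` (Pow A - {A}) \<subseteq> ?P - {2}" "inj_on f0 (Pow A - {A})"
    using card_le_inj[of "Pow A - {A}" "?P - {2}"] A by auto
  define f where "f = f0(A := 2)"
  have fP: "f S \<in> ?P" if "S \<subseteq> A" for S
    using f0(1) two that by (auto simp: f_def)
  have fpos: "f S > 0" if "S \<subseteq> A" for S
    using fP[OF that] prime_gt_0_nat by blast
  have f2: "f S = 2 \<longleftrightarrow> S = A" if "S \<subseteq> A" for S
    using f0(1) that by (auto simp: f_def)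
  have finj: "S = T" if "f S = f T" "S \<subseteq> A" "T \<subseteq> A" for S T
    using f0 that by (auto simp: f_def inj_on_def split: if_splits)
  define B where "B i = {T. T \<subseteq> A \<and> i \<in> T}" for i
  have finB: "finite (B i)" for i
    using A by (auto simp: B_def)
  define c where "c i = 2 * (\<Prod>T\<in>B i. f T)" for i
  have prod_le: "(\<Prod>T\<in>B i. f T) \<le> k" for i
  proof -
    have "(\<Prod>T\<in>B i. f T) = \<Prod>(f ` B i)"
      using finj by (subst prod.reindex) (auto simp only: inj_on_def B_def mem_Collect_eq o_def)
    also have "\<dots> \<le> \<Prod>?P"
    proof (rule dvd_imp_le)
      show "\<Prod>(f ` B i) dvd \<Prod>?P"
        using fP by (intro prod_dvd_prod_subset) (auto simp: B_def)
      show "0 < \<Prod>?P" by (rule prod_pos) (auto intro: prime_gt_0_nat)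
    qed
    finally show ?thesis using primorial_le[of n] assms(2) by linarith
  qed
  \<comment> \<open>A prime divisor \<open>f S\<close> of \<open>c i\<close> is one of the factors \<open>f T\<close> or the extra factor \<open>2 = f A\<close>;
     the latter is harmless since \<open>i \<in> A\<close>.\<close>
  have dvd: "i \<in> S" if S: "S \<subseteq> A" and i: "i \<in> A" and d: "f S dvd c i" for S i
  proof (rule ccontr)
    assume "i \<notin> S"
    then have "f S \<noteq> 2" using f2[OF S] i by auto
    have prS: "prime (f S)" using fP[OF S] by simp
    have "f S dvd 2 \<or> (\<exists>T\<in>B i. f S dvd f T)"
      using d prS unfolding c_def by (simp add: prime_dvd_mult_iff prime_dvd_prod_iff finB)
    moreover have "\<not> f S dvd 2"
      using \<open>f S \<noteq> 2\<close> prS primes_dvd_imp_eq two_is_prime_nat by blast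
    ultimately obtain T where T: "T \<in> B i" "f S dvd f T" by blast
    then have "f S = f T" using fP[of T] prS primes_dvd_imp_eq by (auto simp: B_def)
    then have "S = T" using finj S T by (auto simp: B_def)
    then show False using T \<open>i \<notin> S\<close> by (auto simp: B_def)
  qed
  have zero: "h (f S) k (c i) = 0 \<longleftrightarrow> i \<in> S" if S: "S \<subseteq> A" and i: "i \<in> A" for S i
  proof
    assume "h (f S) k (c i) = 0"
    then have "f S dvd c i" by (auto simp: h_def split: if_splits)
    then show "i \<in> S" using dvd S i by blast
  next
    assume iS: "i \<in> S"
    have prS: "prime (f S)" using fP[OF S] by simp
    define r where "r = (\<Prod>T\<in>B i - {S}. f T)"
    have r: "(\<Prod>T\<in>B i. f T) = f S * r"
      unfolding r_def using finB iS S by (intro prod.remove) (auto simp: B_def)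
    have "r > 0"
      unfolding r_def using fpos by (intro prod_pos) (simp add: B_def)
    moreover have "2 * r \<le> k"
    proof -
      \<comment> \<open>Cancelling \<open>f S \<ge> 2\<close> from \<open>c i\<close> makes up for the factor \<open>2\<close>.\<close>
      have "2 * r \<le> f S * r" using prime_ge_2_nat[OF prS] by simp
      also have "\<dots> \<le> k" using r prod_le[of i] by simp
      finally show ?thesis .
    qed
    ultimately have "c i \<in> {j * f S |j. 2 \<le> j \<and> j \<le> k}"
      unfolding c_def r by (intro CollectI exI[of _ "2 * r"]) auto
    then show "h (f S) k (c i) = 0" by (simp add: h_def)
  qed
  have "inj_on c A"
  proof (rule inj_onI)
    fix i j assume ij: "i \<in> A" "j \<in> A" "c i = c j"
    \<comment> \<open>Only \<open>c i\<close> is a zero of the function that belongs to the singleton of \<open>i\<close>.\<close>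
    have "h (f {i}) k (c i) = 0" using zero[of "{i}" i] ij(1) by blast
    then have "h (f {i}) k (c j) = 0" by (simp only: ij(3))
    then show "i = j" using zero[of "{i}" j] ij(1,2) by blast
  qed
  then have "card (c ` A) = m" using A by (simp add: card_image)
  moreover have "shatters (H' k) (c ` A)"
    unfolding shatters_iff
  proof (intro conjI allI impI)
    show "c ` A \<subseteq> dom_X"
    proof -
      have "(\<Prod>T\<in>B i. f T) > 0" for i
        using fpos by (intro prod_pos) (simp add: B_def)
      then have "c i \<ge> 2" for i unfolding c_def by (simp add: Suc_le_eq)
      then show ?thesis by (auto simp: dom_X_def)
    qed
    show "finite (c ` A)" using A by simp
  next
    fix S assume "S \<subseteq> c ` A"
    then obtain T where T: "T \<subseteq> A" "S = c ` T" by (auto simp: subset_image_iff)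
    have "h (f T) k \<in> H' k"
      using fP[OF T(1)] by (auto simp: H'_def dom_X_def dest: prime_ge_2_nat)
    moreover have "{x \<in> c ` A. h (f T) k x = 0} = S"
      using zero[OF T(1)] T by auto
    ultimately show "\<exists>g\<in>H' k. {x \<in> c ` A. g x = 0} = S" by blast
  qed
  ultimately show ?thesis by blast
qed

lemma VCdim_H'_ge:
  assumes "k \<ge> 2"
  shows "floor_log2 (prime_count (real_of_int (eta k))) \<le> ereal_of_enat (VCdim (H' k))"
proof (cases "prime_count (real_of_int (eta k)) = 0")
  case False
  define n where "n = nat (eta k)"
  define q where "q = prime_count (real n)"
  define m where "m = nat \<lfloor>log 2 (real q)\<rfloor>"
  have "log 2 (real k) \<ge> 0" using assms by (subst zero_le_log_cancel_iff) auto
  then have "eta k \<ge> 0" by (simp add: eta_def)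
  then have n_eta: "real_of_int (eta k) = real n" by (simp add: n_def)
  have n: "real n \<le> log 2 (real k) / 2"
    using n_eta of_int_floor_le[of "log 2 (real k) / 2"] unfolding eta_def by simp
  have q: "q > 0" using False n_eta by (simp add: q_def)
  have log_q: "log 2 (real q) \<ge> 0" using q by (subst zero_le_log_cancel_iff) auto
  have "real m \<le> log 2 (real q)" using log_q by (simp add: m_def)
  then have "2 powr real m \<le> real q" using q by (simp add: le_log_iff)
  then have "real (2 ^ m) \<le> real q" by (simp add: powr_realpow)
  then have m: "2 ^ m \<le> q" by (simp only: of_nat_le_iff)
  have "2 powr real (2 * n) \<le> real k" using n assms by (simp add: le_log_iff mult.commute)
  then have "real (2 ^ (2 * n)) \<le> real k" by (subst (asm) powr_realpow) auto
  then have "4 ^ n \<le> k" by (simp only: of_nat_le_iff power_mult) simp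
  then obtain C where "shatters (H' k) C" "card C = m"
    using shatters_H'_exists m unfolding q_def by blast
  then have "enat m \<le> VCdim (H' k)" using VCdim_ge by blast
  then have "ereal_of_enat (enat m) \<le> ereal_of_enat (VCdim (H' k))"
    by (simp only: ereal_of_enat_le_iff)
  moreover have "floor_log2 (prime_count (real_of_int (eta k))) = ereal (real m)"
    using q log_q by (simp add: floor_log2_def n_eta q_def[symmetric] m_def)
  ultimately show ?thesis by simp
qed (simp add: floor_log2_def)

theorem proposition3p2:
  fixes k :: nat
  assumes "k \<ge> 2"
  shows "floor_log2 (prime_count (real_of_int (eta k))) \<le> ereal_of_enat (VCdim (H' k))
       \<and> VCdim (H' k) \<le> VCdim (H k)
       \<and> ereal_of_enat (VCdim (H k)) \<le> ereal (real_of_int (\<lceil>log 2 (real k - 1)\<rceil> + 1))"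
proof (intro conjI)
  show "VCdim (H' k) \<le> VCdim (H k)"
    by (rule VCdim_mono) (auto simp: H_def H'_def)
qed (rule VCdim_H'_ge[OF assms] VCdim_H_le[OF assms])+

end
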